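(* Let $K=\mathbb{R}$ or $K=\mathbb{C}$, $n\in\mathbb{Z}_{>0}$, and let $\varphi^{[n]}:\mathbb{R}^n\to K$ be an $n$-dimensional tensor product mother scaling function with associated dual projection operators $\tilde P_j$, $j\in\mathbb{Z}$. Let $\tilde f\in C_0(\mathbb{R}^n,K)^*$. Then $\tilde P_j\tilde f\to\tilde f$ in the weak-* topology of $C_0(\mathbb{R}^n,K)^*$ as $j\to\infty$.
   Context: $C_0(\mathbb{R}^n,K)$ is the Banach space of continuous functions $\mathbb{R}^n\to K$ vanishing at infinity with the supremum norm, and $C_0(\mathbb{R}^n,K)^*$ is its topological dual. $\varphi:\mathbb{R}\to K$ is a compactly supported interpolating mother scaling function: it is continuous and compactly supported, $\varphi(k)=\delta_{k,0}$ for all $k\in\mathbb{Z}$, and $\varphi(x)=\sum_{k\in\mathbb{Z}}\varphi(k/2)\varphi(2x-k)$ for all $x\in\mathbb{R}$. The $n$-dimensional tensor product mother scaling function generated by $\varphi$ is $\varphi^{[n]}(x)=\prod_{i=1}^n\varphi(x_i)$, and $\varphi^{[n]}_{j,k}(x)=\varphi^{[n]}(2^jx-k)$. For $j\in\mathbb{Z}$, $k\in\mathbb{Z}^n$ let $\tilde\varphi^{[n]}_{j,k}$ be the functional $f\mapsto f(k/2^j)$, and for $\tilde f\in C_0(\mathbb{R}^n,K)^*$ put $$\tilde P_j\tilde f=\sum_{k\in\mathbb{Z}^n}\langle\tilde f,\varphi^{[n]}_{j,k}\rangle\,\tilde\varphi^{[n]}_{j,k}$$ (the series converges absolutely in $C_0(\mathbb{R}^n,K)^*$).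 *)

theory Defs
  imports "HOL-Analysis.Analysis"
begin

section \<open>The Banach space of continuous functions vanishing at infinity\<close>

typedef (overloaded) ('a, 'k) c0 =
  "{f :: 'a::real_normed_vector \<Rightarrow>\<^sub>C 'k::real_normed_vector. (apply_bcontfun f \<longlongrightarrow> 0) at_infinity}"
  morphisms bcontfun_of_c0 Abs_c0
  by (rule exI[of _ 0]) simp

setup_lifting type_definition_c0

instantiation c0 :: (real_normed_vector, real_normed_vector) real_vector
begin

lift_definition zero_c0 :: "('a, 'b) c0" is 0 by simp

lift_definition plus_c0 :: "('a, 'b) c0 \<Rightarrow> ('a, 'b) c0 \<Rightarrow> ('a, 'b) c0" is "(+)"
  by (auto intro: tendsto_add_zero)

lift_definition uminus_c0 :: "('a, 'b) c0 \<Rightarrow> ('a, 'b) c0" is uminus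
  by (drule tendsto_minus) simp

lift_definition minus_c0 :: "('a, 'b) c0 \<Rightarrow> ('a, 'b) c0 \<Rightarrow> ('a, 'b) c0" is "(-)"
  by (drule (1) tendsto_diff) simp

lift_definition scaleR_c0 :: "real \<Rightarrow> ('a, 'b) c0 \<Rightarrow> ('a, 'b) c0" is "(*\<^sub>R)"
  by (drule tendsto_scaleR[OF tendsto_const]) simp

instance
  by standard (transfer; simp add: algebra_simps)+

end

instantiation c0 :: (real_normed_vector, real_normed_vector) real_normed_vector
begin

text \<open>The norm is inherited from bounded continuous functions, where it is the supremum norm.\<close>

lift_definition norm_c0 :: "('a, 'b) c0 \<Rightarrow> real" is norm .

lift_definition dist_c0 :: "('a, 'b) c0 \<Rightarrow> ('a, 'b) c0 \<Rightarrow> real" is dist .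

definition sgn_c0 :: "('a, 'b) c0 \<Rightarrow> ('a, 'b) c0"
  where "sgn_c0 f = f /\<^sub>R norm f"

definition uniformity_c0 :: "(('a, 'b) c0 \<times> ('a, 'b) c0) filter"
  where "uniformity_c0 = (INF e\<in>{0<..}. principal {(x, y). dist x y < e})"

definition open_c0 :: "('a, 'b) c0 set \<Rightarrow> bool"
  where "open_c0 S = (\<forall>x\<in>S. \<forall>\<^sub>F (x', y) in uniformity. x' = x \<longrightarrow> y \<in> S)"

instance
proof
  fix f g :: "('a, 'b) c0" and a :: real
  show "dist f g = norm (f - g)"
    by transfer (rule dist_norm)
  show "norm f = 0 \<longleftrightarrow> f = 0"
    by transfer simp
  show "norm (f + g) \<le> norm f + norm g"
    by transfer (rule norm_triangle_ineq)
  show "norm (a *\<^sub>R f) = \<bar>a\<bar> * norm f"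
    by transfer simp
qed (rule sgn_c0_def uniformity_c0_def open_c0_def)+

end

definition c0_apply :: "('a::real_normed_vector, 'k::real_normed_vector) c0 \<Rightarrow> 'a \<Rightarrow> 'k"
  where "c0_apply f = apply_bcontfun (bcontfun_of_c0 f)"

text \<open>The element of \<open>c0\<close> with a given underlying function; unspecified if the function is not
  continuous or does not vanish at infinity.\<close>

definition c0_of_fun :: "('a::real_normed_vector \<Rightarrow> 'k::real_normed_vector) \<Rightarrow> ('a, 'k) c0"
  where "c0_of_fun g = Abs_c0 (Bcontfun g)"

lemma c0_apply_c0_of_fun:
  fixes g :: "'a::euclidean_space \<Rightarrow> 'k::real_normed_vector"
  assumes cont: "continuous_on UNIV g" and lim: "(g \<longlongrightarrow> 0) at_infinity"
  shows "c0_apply (c0_of_fun g) = g"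
proof -
  obtain B where B: "\<And>x. B \<le> norm x \<Longrightarrow> norm (g x) < 1"
    using tendstoD[OF lim, of 1] by (auto simp: eventually_at_infinity)
  have "bounded (g ` cball 0 B)"
    by (intro compact_imp_bounded compact_continuous_image continuous_on_subset[OF cont]) auto
  then obtain C where "\<forall>y\<in>g ` cball 0 B. norm y \<le> C"
    unfolding bounded_iff by blast
  then have C: "norm (g x) \<le> C" if "norm x \<le> B" for x
    using that by simp
  have "norm (g x) \<le> max C 1" for x
    using B[of x] C[of x] by (cases "norm x \<le> B") auto
  then have "g \<in> bcontfun"
    by (rule bcontfun_normI[OF cont])
  then have "apply_bcontfun (Bcontfun g) = g"
    by (rule Bcontfun_inverse)
  then show ?thesis
    using lim by (simp add: c0_apply_def c0_of_fun_def Abs_c0_inverse)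
qed

lemma norm_c0_apply_le: "norm (c0_apply f x) \<le> norm f"
  unfolding c0_apply_def by transfer (rule norm_bounded)

lemma norm_c0_eq_SUP: "norm f = (SUP x. norm (c0_apply f x))"
  unfolding c0_apply_def
  by (simp add: norm_c0.rep_eq norm_bcontfun_def dist_bcontfun.rep_eq)

instance c0 :: (real_normed_vector, banach) banach
proof
  fix X :: "nat \<Rightarrow> ('a, 'b) c0"
  assume "Cauchy X"
  then have "Cauchy (\<lambda>n. bcontfun_of_c0 (X n))"
    by (simp add: Cauchy_def dist_c0.rep_eq)
  then obtain g where g: "(\<lambda>n. bcontfun_of_c0 (X n)) \<longlonglongrightarrow> g"
    using Cauchy_convergent convergent_def by blast
  have "(apply_bcontfun g \<longlongrightarrow> 0) at_infinity"
  proof (rule tendstoI)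
    fix e :: real
    assume "e > 0"
    then obtain n where n: "dist (bcontfun_of_c0 (X n)) g < e / 2"
      using metric_LIMSEQ_D[OF g, of "e / 2"] by auto
    have "(apply_bcontfun (bcontfun_of_c0 (X n)) \<longlongrightarrow> 0) at_infinity"
      using bcontfun_of_c0 by auto
    then have "\<forall>\<^sub>F x in at_infinity. dist (apply_bcontfun (bcontfun_of_c0 (X n)) x) 0 < e / 2"
      using \<open>e > 0\<close> by (intro tendstoD) auto
    then show "\<forall>\<^sub>F x in at_infinity. dist (apply_bcontfun g x) 0 < e"
    proof eventually_elim
      case (elim x)
      then show ?case
        using dist_fun_lt_imp_dist_val_lt[OF n, of x] by (metis dist_commute dist_triangle_half_r)
    qed
  qed
  then have "bcontfun_of_c0 (Abs_c0 g) = g"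
    by (simp add: Abs_c0_inverse)
  then have "X \<longlonglongrightarrow> Abs_c0 g"
    using g by (simp add: tendsto_iff dist_c0.rep_eq)
  then show "convergent X"
    by (auto simp: convergent_def)
qed


section \<open>The dual space and its weak-* topology\<close>

lift_definition c0_scale ::
    "'k::real_normed_field \<Rightarrow> ('a::real_normed_vector, 'k) c0 \<Rightarrow> ('a, 'k) c0"
  is "\<lambda>c f. Bcontfun (\<lambda>x. c * apply_bcontfun f x)"
proof -
  fix c :: 'k and f :: "'a \<Rightarrow>\<^sub>C 'k"
  assume lim: "(apply_bcontfun f \<longlongrightarrow> 0) at_infinity"
  have "(\<lambda>x. c * apply_bcontfun f x) \<in> bcontfun"
    by (rule bcontfun_normI[where b = "norm c * norm f"])
      (auto intro!: continuous_intros mult_left_mono norm_bounded simp: norm_mult)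
  then show "(apply_bcontfun (Bcontfun (\<lambda>x. c * apply_bcontfun f x)) \<longlongrightarrow> 0) at_infinity"
    by (simp add: Bcontfun_inverse tendsto_mult_right_zero[OF lim])
qed

lemma c0_apply_c0_scale [simp]: "c0_apply (c0_scale c f) x = c * c0_apply f x"
proof -
  have "(\<lambda>x. c * apply_bcontfun (bcontfun_of_c0 f) x) \<in> bcontfun"
    by (rule bcontfun_normI[where b = "norm c * norm (bcontfun_of_c0 f)"])
      (auto intro!: continuous_intros mult_left_mono norm_bounded simp: norm_mult)
  then show ?thesis
    by (simp add: c0_apply_def c0_scale.rep_eq Bcontfun_inverse)
qed

text \<open>The library's bounded linear functions are only real-linear, so homogeneity over the
  scalar field is imposed separately (it is automatic for the real field).\<close>

definition c0_dual :: "(('a::real_normed_vector, 'k::real_normed_field) c0 \<Rightarrow>\<^sub>L 'k) set"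
  where "c0_dual = {F. \<forall>c f. blinfun_apply F (c0_scale c f) = c * blinfun_apply F f}"

text \<open>For scalar-valued operators the strong operator topology is the topology of pointwise
  convergence, i.e. the coarsest one making all evaluations \<open>F \<mapsto> F f\<close> continuous.\<close>

definition weak_star_topology ::
    "(('a::real_normed_vector, 'k::real_normed_field) c0 \<Rightarrow>\<^sub>L 'k) topology"
  where "weak_star_topology = subtopology strong_operator_topology c0_dual"

definition dual_scale :: "'k::real_normed_field \<Rightarrow> ('a::real_normed_vector, 'k) c0 \<Rightarrow>\<^sub>L 'k
    \<Rightarrow> ('a, 'k) c0 \<Rightarrow>\<^sub>L 'k"
  where "dual_scale c F = blinfun_mult_right c o\<^sub>L F"

lift_definition c0_eval :: "'a::real_normed_vector \<Rightarrow> ('a, 'k::real_normed_field) c0 \<Rightarrow>\<^sub>L 'k"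
  is "\<lambda>x f. c0_apply f x"
proof
  fix x :: 'a and f g :: "('a, 'k) c0" and r :: real
  show "c0_apply (f + g) x = c0_apply f x + c0_apply g x"
    by (simp add: c0_apply_def plus_c0.rep_eq)
  show "c0_apply (r *\<^sub>R f) x = r *\<^sub>R c0_apply f x"
    by (simp add: c0_apply_def scaleR_c0.rep_eq)
  show "\<exists>K. \<forall>f :: ('a, 'k) c0. norm (c0_apply f x) \<le> norm f * K"
    using norm_c0_apply_le by (intro exI[of _ 1]) auto
qed


section \<open>Interpolating scaling functions and dual projections\<close>

text \<open>In the refinement equation only finitely many terms are nonzero for each \<open>x\<close>.\<close>

definition mother_scaling_function :: "(real \<Rightarrow> 'k::real_normed_field) \<Rightarrow> bool"
  where "mother_scaling_function \<phi> \<longleftrightarrow>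
    continuous_on UNIV \<phi> \<and>
    compact (closure {x. \<phi> x \<noteq> 0}) \<and>
    (\<forall>k::int. \<phi> (of_int k) = (if k = 0 then 1 else 0)) \<and>
    (\<forall>x. \<phi> x = (\<Sum>\<^sub>\<infinity>k::int. \<phi> (of_int k / 2) * \<phi> (2 * x - of_int k)))"

definition tensor_power :: "(real \<Rightarrow> 'k::real_normed_field) \<Rightarrow> real ^ 'n \<Rightarrow> 'k"
  where "tensor_power \<phi> x = (\<Prod>i\<in>UNIV. \<phi> (x $ i))"

definition tensor_mother_scaling_function :: "(real ^ 'n \<Rightarrow> 'k::real_normed_field) \<Rightarrow> bool"
  where "tensor_mother_scaling_function \<Phi> \<longleftrightarrow>
    (\<exists>\<phi>. mother_scaling_function \<phi> \<and> \<Phi> = tensor_power \<phi>)"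

definition vec_of_int :: "int ^ 'n \<Rightarrow> real ^ 'n"
  where "vec_of_int k = (\<chi> i. of_int (k $ i))"

definition scaling_fun :: "(real ^ 'n \<Rightarrow> 'k::real_normed_field) \<Rightarrow> int \<Rightarrow> int ^ 'n
    \<Rightarrow> (real ^ 'n, 'k) c0"
  where "scaling_fun \<Phi> j k = c0_of_fun (\<lambda>x. \<Phi> ((2 powi j) *\<^sub>R x - vec_of_int k))"

lemma c0_apply_scaling_fun:
  fixes \<Phi> :: "real ^ 'n \<Rightarrow> 'k::real_normed_field"
  assumes "tensor_mother_scaling_function \<Phi>"
  shows "c0_apply (scaling_fun \<Phi> j k) x = \<Phi> ((2 powi j) *\<^sub>R x - vec_of_int k)"
proof -
  obtain \<phi> where \<phi>: "mother_scaling_function \<phi>" and \<Phi>: "\<Phi> = tensor_power \<phi>"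
    using assms by (auto simp: tensor_mother_scaling_function_def)
  have cont: "continuous_on UNIV \<phi>"
    using \<phi> unfolding mother_scaling_function_def by blast
  have "compact (closure {x. \<phi> x \<noteq> 0})"
    using \<phi> unfolding mother_scaling_function_def by blast
  then have "bounded {x. \<phi> x \<noteq> 0}"
    by (rule bounded_subset[OF compact_imp_bounded closure_subset])
  then obtain B where "\<forall>x\<in>{x. \<phi> x \<noteq> 0}. \<bar>x\<bar> \<le> B"
    unfolding bounded_iff real_norm_def by blast
  then have B: "\<bar>x\<bar> \<le> B" if "\<phi> x \<noteq> 0" for x
    using that by simp
  have zero: "\<Phi> y = 0" if y: "norm y > real CARD('n) * B" for y :: "real ^ 'n"
  proof (rule ccontr)
    assume "\<Phi> y \<noteq> 0"
    then have "\<bar>y $ i\<bar> \<le> B" for i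
      using B by (auto simp: \<Phi> tensor_power_def)
    then have "(\<Sum>i\<in>UNIV. \<bar>y $ i\<bar>) \<le> real CARD('n) * B"
      using sum_bounded_above[of UNIV "\<lambda>i. \<bar>y $ i\<bar>" B] by simp
    then show False
      using y norm_le_l1_cart[of y] by linarith
  qed
  let ?g = "\<lambda>x. \<Phi> ((2 powi j) *\<^sub>R x - vec_of_int k)"
  have "continuous_on UNIV \<Phi>"
    unfolding \<Phi> tensor_power_def
    by (intro continuous_on_prod continuous_on_compose2[OF cont] continuous_intros) auto
  then have 1: "continuous_on UNIV ?g"
    by (rule continuous_on_compose2) (auto intro!: continuous_intros)
  define s :: real where "s = 2 powi j"
  have s: "s > 0" by (simp add: s_def)
  define R where "R = (real CARD('n) * B + norm (vec_of_int k) + 1) / s"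
  have "?g x = 0" if "R \<le> norm x" for x
  proof (rule zero)
    have "real CARD('n) * B + norm (vec_of_int k) + 1 \<le> norm (s *\<^sub>R x)"
      using that s by (simp add: R_def field_simps)
    also have "\<dots> \<le> norm (s *\<^sub>R x - vec_of_int k) + norm (vec_of_int k)"
      using norm_triangle_ineq[of "s *\<^sub>R x - vec_of_int k" "vec_of_int k"] by simp
    finally show "real CARD('n) * B < norm ((2 powi j) *\<^sub>R x - vec_of_int k)"
      by (simp add: s_def)
  qed
  then have 2: "(?g \<longlongrightarrow> 0) at_infinity"
    by (intro tendsto_eventually) (auto simp: eventually_at_infinity)
  show ?thesis
    unfolding scaling_fun_def by (simp add: c0_apply_c0_of_fun[OF 1 2])
qed

definition dual_scaling_functional :: "int \<Rightarrow> int ^ 'n \<Rightarrow> (real ^ 'n, 'k::real_normed_field) c0 \<Rightarrow>\<^sub>L 'k"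
  where "dual_scaling_functional j k = c0_eval (vec_of_int k /\<^sub>R (2 powi j))"

text \<open>The series is an unordered sum in the operator norm topology of the dual.\<close>

definition dual_projection :: "(real ^ 'n \<Rightarrow> 'k::real_normed_field) \<Rightarrow> int
    \<Rightarrow> (real ^ 'n, 'k) c0 \<Rightarrow>\<^sub>L 'k \<Rightarrow> (real ^ 'n, 'k) c0 \<Rightarrow>\<^sub>L 'k"
  where "dual_projection \<Phi> j F =
    (\<Sum>\<^sub>\<infinity>k::int ^ 'n. dual_scale (blinfun_apply F (scaling_fun \<Phi> j k)) (dual_scaling_functional j k))"

end

theory Submission
  imports Defs
begin

text \<open>
  The operator \<open>dual_projection \<Phi> j\<close> is the transpose of interpolation on the grid of mesh size \<open>2 powi (- j)\<close>: applied to a test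
  function \<open>f\<close>, the functional \<open>dual_projection \<Phi> j F\<close> is the limit of the values of \<open>F\<close> at the finite
  interpolation sums \<open>\<Sum>k. f(k/2^j) \<Phi>(2^j x - k)\<close>. Weak-* convergence is therefore the statement
  that these sums approximate \<open>f\<close> in the supremum norm, after which \<open>F\<close>, being bounded, carries the
  estimate over (\<open>interpolation_converges\<close>, \<open>dual_projection_tendsto\<close>).

  Interpolation converges because the integer translates of \<open>\<Phi>\<close> have support of fixed size, absolute
  sum bounded by a constant, and sum one: the error at \<open>x\<close> is then a combination
  \<open>\<Sum>k. (f(k/2^j) - f(x)) \<Phi>(2^j x - k)\<close> in which only grid points close to \<open>x\<close> occur, and \<open>f\<close> is
  uniformly continuous.

  That the translates sum to one is not among the axioms of a scaling function. It is forced by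
  refinement, interpolation and continuity together. Iterating the refinement equation gives
  \<open>\<phi>(x) = \<Sum>n. \<phi>(n/2^i) \<phi>(2^i x - n)\<close> for all \<open>i\<close> (\<open>iterated_refinement\<close>). At \<open>x = y/2^i\<close> the second
  factor \<open>\<phi>(y - n)\<close> does not depend on \<open>i\<close> and vanishes for all but finitely many \<open>n\<close>, while
  \<open>\<phi>(y/2^i)\<close> and each \<open>\<phi>(n/2^i)\<close> tend to \<open>\<phi>(0) = 1\<close>; in the limit \<open>1 = \<Sum>n. \<phi>(y - n)\<close>
  (\<open>translates_sum_to_one\<close>).

  The dual series converges absolutely because a functional that is linear over the scalar field
  can be tested against combinations with unimodular coefficients chosen to align the phases of all
  terms (\<open>dual_abs_sum_le\<close>). Everything works over any complete normed field; the theorem is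
  the specialisation to the real and complex numbers.
\<close>

section \<open>Univariate scaling functions\<close>

lemma infsum_finite_support:
  fixes f :: "'a \<Rightarrow> 'b::{comm_monoid_add, t2_space}"
  assumes "finite A" "\<And>x. x \<notin> A \<Longrightarrow> f x = 0"
  shows "infsum f UNIV = sum f A"
proof -
  have "infsum f UNIV = infsum f A"
    using assms(2) by (intro infsum_cong_neutral) auto
  then show ?thesis
    using assms(1) by simp
qed

text \<open>The refinement equation has an instance of its left-hand side on the right, so it is kept apart
  from the other properties to be used as a controlled rewrite step.\<close>

lemma mother_scaling_functionD:
  fixes \<phi> :: "real \<Rightarrow> 'k::real_normed_field"
  assumes "mother_scaling_function \<phi>"
  shows mother_scaling_continuous: "continuous_on UNIV \<phi>"
    and mother_scaling_zero: "\<phi> 0 = 1"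
    and mother_scaling_int: "k \<noteq> 0 \<Longrightarrow> \<phi> (of_int k) = 0"
    and mother_scaling_refinement:
      "\<phi> x = (\<Sum>\<^sub>\<infinity>k::int. \<phi> (of_int k / 2) * \<phi> (2 * x - of_int k))"
proof -
  have cardinal: "\<forall>k::int. \<phi> (of_int k) = (if k = 0 then 1 else 0)"
    using assms unfolding mother_scaling_function_def by blast
  show "\<phi> 0 = 1"
    using spec[OF cardinal, of 0] by simp
  show "\<phi> (of_int k) = 0" if "k \<noteq> 0"
    using spec[OF cardinal, of k] that by simp
qed (use assms in \<open>unfold mother_scaling_function_def, blast\<close>)+

lemma mother_scaling_support:
  fixes \<phi> :: "real \<Rightarrow> 'k::real_normed_field"
  assumes "mother_scaling_function \<phi>"
  obtains B where "B > 0" "\<And>x. \<phi> x \<noteq> 0 \<Longrightarrow> \<bar>x\<bar> \<le> B"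
proof -
  have "bounded {x. \<phi> x \<noteq> 0}"
    using assms unfolding mother_scaling_function_def
    by (metis bounded_subset closure_subset compact_imp_bounded)
  then obtain B where "B > 0" "\<forall>x\<in>{x. \<phi> x \<noteq> 0}. \<bar>x\<bar> \<le> B"
    unfolding bounded_pos by auto
  then show thesis
    using that by blast
qed

lemma finite_int_affine_abs_le: "finite {k::int. \<bar>c * of_int k + d\<bar> \<le> B}" if "c \<noteq> 0" for c d B :: real
proof (rule finite_subset)
  show "{k::int. \<bar>c * of_int k + d\<bar> \<le> B} \<subseteq> {- \<lceil>(B + \<bar>d\<bar>) / \<bar>c\<bar>\<rceil>..\<lceil>(B + \<bar>d\<bar>) / \<bar>c\<bar>\<rceil>}"
  proof
    fix k :: int
    assume "k \<in> {k. \<bar>c * of_int k + d\<bar> \<le> B}"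
    then have "\<bar>c * of_int k\<bar> \<le> B + \<bar>d\<bar>"
      by auto
    then have "\<bar>of_int k\<bar> \<le> (B + \<bar>d\<bar>) / \<bar>c\<bar>"
      using that by (simp add: abs_mult field_simps)
    then show "k \<in> {- \<lceil>(B + \<bar>d\<bar>) / \<bar>c\<bar>\<rceil>..\<lceil>(B + \<bar>d\<bar>) / \<bar>c\<bar>\<rceil>}"
      by (simp add: abs_le_iff le_ceiling_iff) linarith
  qed
qed simp

lemma finite_affine_support:
  fixes \<phi> :: "real \<Rightarrow> 'k::real_normed_field"
  assumes "mother_scaling_function \<phi>" and "c \<noteq> 0"
  shows "finite {k::int. \<phi> (c * of_int k + d) \<noteq> 0}"
proof -
  obtain B where B: "\<And>x. \<phi> x \<noteq> 0 \<Longrightarrow> \<bar>x\<bar> \<le> B"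
    using mother_scaling_support[OF assms(1)] by blast
  show ?thesis
    using B by (intro finite_subset[OF _ finite_int_affine_abs_le[OF assms(2), of d B]]) auto
qed

lemma finite_translate_support:
  fixes \<phi> :: "real \<Rightarrow> 'k::real_normed_field"
  assumes "mother_scaling_function \<phi>"
  shows "finite {k::int. \<phi> (x - of_int k) \<noteq> 0}"
  using finite_affine_support[OF assms, of "-1" x] by simp

text \<open>Refining \<open>\<phi>(2x - k)\<close> by the case \<open>i\<close> and collecting the terms that contain
  \<open>\<phi>(2^(i+1) x - m)\<close> leaves the coefficient \<open>\<Sum>k. \<phi>(k/2) \<phi>(m/2^i - k)\<close>, which is the refinement equation
  at the dyadic point \<open>m/2^(i+1)\<close>. The coefficients thus stay samples of \<open>\<phi>\<close>; for \<open>i = 0\<close> the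
  identity is the interpolation property.\<close>

lemma iterated_refinement:
  fixes \<phi> :: "real \<Rightarrow> 'k::{real_normed_field, banach}"
  assumes \<phi>: "mother_scaling_function \<phi>"
  shows "\<phi> x = (\<Sum>\<^sub>\<infinity>n::int. \<phi> (of_int n / 2 ^ i) * \<phi> (2 ^ i * x - of_int n))"
proof (induction i arbitrary: x)
  case 0
  have "(\<Sum>\<^sub>\<infinity>n::int. \<phi> (of_int n / 2 ^ 0) * \<phi> (2 ^ 0 * x - of_int n))
      = (\<Sum>n\<in>{0::int}. \<phi> (of_int n / 2 ^ 0) * \<phi> (2 ^ 0 * x - of_int n))"
    by (intro infsum_finite_support) (auto simp: mother_scaling_int[OF \<phi>])
  also have "\<dots> = \<phi> x"
    by (simp add: mother_scaling_zero[OF \<phi>])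
  finally show ?case
    by simp
next
  case (Suc i)
  \<comment> \<open>The summation index \<open>n\<close> of the inner expansion is replaced by \<open>m = n + 2^i k\<close>.\<close>
  define g where "g k m = \<phi> (of_int k / 2) * \<phi> (of_int m / 2 ^ i - of_int k)
      * \<phi> (2 ^ Suc i * x - of_int m)" for k m :: int
  have summable: "(\<lambda>(k, m). g k m) summable_on UNIV \<times> UNIV"
  proof (rule finite_nonzero_values_imp_summable_on)
    have "finite ({k::int. \<phi> (of_int k / 2) \<noteq> 0} \<times> {m::int. \<phi> (2 ^ Suc i * x - of_int m) \<noteq> 0})"
      using finite_affine_support[OF \<phi>, of "1 / 2" 0] finite_translate_support[OF \<phi>]
      by (intro finite_cartesian_product) auto
    then show "finite {p \<in> UNIV \<times> UNIV. (case p of (k, m) \<Rightarrow> g k m) \<noteq> 0}"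
      by (rule rev_finite_subset) (auto simp: g_def)
  qed
  have inner: "(\<Sum>\<^sub>\<infinity>m. g k m) = \<phi> (of_int k / 2) * \<phi> (2 * x - of_int k)" for k
  proof -
    have "bij_betw (\<lambda>m::int. m - 2 ^ i * k) UNIV UNIV"
      by (rule bij_betw_byWitness[where f' = "\<lambda>n. n + 2 ^ i * k"]) auto
    then have "\<phi> (2 * x - of_int k) = (\<Sum>\<^sub>\<infinity>m::int. \<phi> (of_int (m - 2 ^ i * k) / 2 ^ i)
        * \<phi> (2 ^ i * (2 * x - of_int k) - of_int (m - 2 ^ i * k)))"
      by (subst Suc.IH) (rule infsum_reindex_bij_betw[symmetric])
    also have "\<dots> = (\<Sum>\<^sub>\<infinity>m::int. \<phi> (of_int m / 2 ^ i - of_int k) * \<phi> (2 ^ Suc i * x - of_int m))"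
      by (intro infsum_cong arg_cong2[of _ _ _ _ "(*)"] arg_cong[of _ _ \<phi>])
        (auto simp: field_simps)
    finally show ?thesis
      by (simp add: g_def mult.assoc flip: infsum_cmult_right')
  qed
  have "\<phi> x = (\<Sum>\<^sub>\<infinity>k. \<Sum>\<^sub>\<infinity>m. g k m)"
    by (subst mother_scaling_refinement[OF \<phi>]) (simp add: inner)
  also have "\<dots> = (\<Sum>\<^sub>\<infinity>m. \<Sum>\<^sub>\<infinity>k. g k m)"
    by (rule infsum_swap_banach[OF summable])
  also have "\<dots> = (\<Sum>\<^sub>\<infinity>m::int. \<phi> (of_int m / 2 ^ Suc i) * \<phi> (2 ^ Suc i * x - of_int m))"
  proof (rule infsum_cong)
    fix m :: int
    show "(\<Sum>\<^sub>\<infinity>k. g k m) = \<phi> (of_int m / 2 ^ Suc i) * \<phi> (2 ^ Suc i * x - of_int m)"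
      by (subst mother_scaling_refinement[OF \<phi>, of "of_int m / 2 ^ Suc i"]) (simp add: g_def infsum_cmult_left')
  qed
  finally show ?case .
qed

text \<open>The iterated refinement at \<open>x/2^i\<close> has the \<open>i\<close>-independent weights \<open>\<phi>(x - k)\<close>, and all samples of
  \<open>\<phi>\<close> in it move to the origin, where \<open>\<phi>\<close> is continuous with value one.\<close>

lemma translates_sum_to_one:
  fixes \<phi> :: "real \<Rightarrow> 'k::{real_normed_field, banach}"
  assumes \<phi>: "mother_scaling_function \<phi>"
    and A: "finite A" "{k::int. \<phi> (x - of_int k) \<noteq> 0} \<subseteq> A"
  shows "(\<Sum>k\<in>A. \<phi> (x - of_int k)) = 1"
proof -
  have cont: "isCont \<phi> 0"
    using mother_scaling_continuous[OF \<phi>] by (simp add: continuous_on_eq_continuous_at)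
  have lim: "(\<lambda>i. \<phi> (c / 2 ^ i)) \<longlonglongrightarrow> 1" for c :: real
  proof -
    have "(\<lambda>i. c / 2 ^ i) \<longlonglongrightarrow> 0"
      using tendsto_mult_right_zero[OF LIMSEQ_power_zero[of "1 / 2 :: real"], of c]
      by (simp add: power_one_over)
    from isCont_tendsto_compose[OF cont this] show ?thesis
      using mother_scaling_zero[OF \<phi>] by simp
  qed
  have "\<phi> (x / 2 ^ i) = (\<Sum>k\<in>A. \<phi> (of_int k / 2 ^ i) * \<phi> (x - of_int k))" for i
  proof -
    have "\<phi> (x / 2 ^ i)
        = (\<Sum>\<^sub>\<infinity>n::int. \<phi> (of_int n / 2 ^ i) * \<phi> (2 ^ i * (x / 2 ^ i) - of_int n))"
      by (rule iterated_refinement[OF \<phi>])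
    then show ?thesis
      using A by (subst (asm) infsum_finite_support[of A]) auto
  qed
  moreover have "(\<lambda>i. \<Sum>k\<in>A. \<phi> (of_int k / 2 ^ i) * \<phi> (x - of_int k))
      \<longlonglongrightarrow> (\<Sum>k\<in>A. 1 * \<phi> (x - of_int k))"
    by (intro tendsto_sum tendsto_mult_right lim)
  ultimately show ?thesis
    using LIMSEQ_unique[OF lim[of x]] by simp
qed

text \<open>At most \<open>2B + 1\<close> integers lie within distance \<open>B\<close> of a given point, whatever the point is.\<close>

lemma translates_abs_bounded:
  fixes \<phi> :: "real \<Rightarrow> 'k::real_normed_field"
  assumes \<phi>: "mother_scaling_function \<phi>"
  obtains C where "C \<ge> 0" "\<And>x A. finite A \<Longrightarrow> (\<Sum>k\<in>A. norm (\<phi> (x - of_int k))) \<le> C"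
proof -
  obtain B where B: "B > 0" "\<And>x. \<phi> x \<noteq> 0 \<Longrightarrow> \<bar>x\<bar> \<le> B"
    using mother_scaling_support[OF \<phi>] by blast
  have "bounded (\<phi> ` cball 0 B)"
    using continuous_on_subset[OF mother_scaling_continuous[OF \<phi>]]
    by (intro compact_imp_bounded compact_continuous_image) auto
  then obtain M where M: "M > 0" "\<And>x. \<bar>x\<bar> \<le> B \<Longrightarrow> norm (\<phi> x) \<le> M"
    unfolding bounded_pos by auto
  have "(\<Sum>k\<in>A. norm (\<phi> (x - of_int k))) \<le> (2 * B + 1) * M" if "finite A" for x and A :: "int set"
  proof -
    let ?I = "{\<lceil>x - B\<rceil>..\<lfloor>x + B\<rfloor>}"
    have "(\<Sum>k\<in>A. norm (\<phi> (x - of_int k))) = (\<Sum>k\<in>A \<inter> ?I. norm (\<phi> (x - of_int k)))"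
    proof (rule sum.mono_neutral_right[OF that])
      show "\<forall>k\<in>A - A \<inter> ?I. norm (\<phi> (x - of_int k)) = 0"
      proof
        fix k assume "k \<in> A - A \<inter> ?I"
        then have "\<not> \<bar>x - of_int k\<bar> \<le> B"
          by (auto simp: abs_le_iff ceiling_le_iff le_floor_iff)
        then show "norm (\<phi> (x - of_int k)) = 0"
          using B(2) by auto
      qed
    qed auto
    also have "\<dots> \<le> (\<Sum>k\<in>?I. norm (\<phi> (x - of_int k)))"
      by (rule sum_mono2) auto
    also have "\<dots> \<le> real (card ?I) * M"
      by (rule sum_bounded_above, rule M) (auto simp: abs_le_iff ceiling_le_iff le_floor_iff)
    also have "real (card ?I) \<le> 2 * B + 1"
      using B(1) by (simp, linarith)
    finally show ?thesis
      using M by (simp add: mult_right_mono)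
  qed
  then show thesis
    using that[of "(2 * B + 1) * M"] B M by auto
qed

section \<open>Tensor products\<close>

text \<open>Sums over a box in the integer lattice factor into univariate sums, which transfers the partition
  of unity and the absolute bound from \<open>\<phi>\<close> to its tensor powers.\<close>

lemma sum_vec_box_prod:
  assumes "\<And>i. finite (A i)"
  shows "(\<Sum>k\<in>{k :: int ^ 'n. \<forall>i. k $ i \<in> A i}. \<Prod>i\<in>UNIV. f i (k $ i))
      = (\<Prod>i\<in>UNIV. \<Sum>m\<in>A i. f i m :: 'a::comm_semiring_1)"
proof -
  have "(\<Prod>i\<in>UNIV. \<Sum>m\<in>A i. f i m) = (\<Sum>g\<in>PiE UNIV A. \<Prod>i\<in>UNIV. f i (g i))"
    using assms by (intro prod_sum_PiE) auto
  also have "\<dots> = (\<Sum>k\<in>{k. \<forall>i. k $ i \<in> A i}. \<Prod>i\<in>UNIV. f i (k $ i))"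
    by (rule sum.reindex_bij_witness[where i = "vec_nth" and j = "vec_lambda"]) auto
  finally show ?thesis ..
qed

lemma finite_vec_box:
  assumes "\<And>i. finite (A i)"
  shows "finite {k :: 'a ^ 'n. \<forall>i. k $ i \<in> A i}"
proof -
  have "{k :: 'a ^ 'n. \<forall>i. k $ i \<in> A i} \<subseteq> vec_lambda ` PiE UNIV A"
    by (auto intro!: image_eqI[where x = "vec_nth _"])
  moreover have "finite (vec_lambda ` PiE (UNIV :: 'n set) A)"
    using assms by (intro finite_imageI finite_PiE) auto
  ultimately show ?thesis
    by (rule finite_subset)
qed


lemma tensor_power_translate:
  "tensor_power \<phi> (x - vec_of_int k) = (\<Prod>i\<in>UNIV. \<phi> (x $ i - of_int (k $ i)))"
  by (simp add: tensor_power_def vec_of_int_def)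

lemma tensor_support:
  fixes \<Phi> :: "real ^ 'n \<Rightarrow> 'k::real_normed_field"
  assumes "tensor_mother_scaling_function \<Phi>"
  obtains R where "R > 0" "\<And>y. \<Phi> y \<noteq> 0 \<Longrightarrow> norm y \<le> R"
proof -
  obtain \<phi> where \<phi>: "mother_scaling_function \<phi>" and \<Phi>: "\<Phi> = tensor_power \<phi>"
    using assms by (auto simp: tensor_mother_scaling_function_def)
  obtain B where B: "B > 0" "\<And>x. \<phi> x \<noteq> 0 \<Longrightarrow> \<bar>x\<bar> \<le> B"
    using mother_scaling_support[OF \<phi>] by blast
  have "norm y \<le> real CARD('n) * B" if "\<Phi> y \<noteq> 0" for y
  proof -
    have "\<bar>y $ i\<bar> \<le> B" for i
      using that B(2) by (auto simp: \<Phi> tensor_power_def)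
    then have "(\<Sum>i\<in>UNIV. \<bar>y $ i\<bar>) \<le> real CARD('n) * B"
      using sum_bounded_above[of UNIV "\<lambda>i. \<bar>y $ i\<bar>" B] by simp
    then show ?thesis
      using norm_le_l1_cart[of y] by linarith
  qed
  then show thesis
    using that[of "real CARD('n) * B"] B(1) by simp
qed

lemma tensor_translates_finite:
  fixes \<Phi> :: "real ^ 'n \<Rightarrow> 'k::real_normed_field"
  assumes "tensor_mother_scaling_function \<Phi>"
  shows "finite {k. \<Phi> (x - vec_of_int k) \<noteq> 0}"
proof -
  obtain \<phi> where \<phi>: "mother_scaling_function \<phi>" and \<Phi>: "\<Phi> = tensor_power \<phi>"
    using assms by (auto simp: tensor_mother_scaling_function_def)
  have "{k. \<Phi> (x - vec_of_int k) \<noteq> 0}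
      = {k. \<forall>i. k $ i \<in> {m. \<phi> (x $ i - of_int m) \<noteq> 0}}"
    by (auto simp: \<Phi> tensor_power_translate)
  then show ?thesis
    using finite_translate_support[OF \<phi>] by (simp only: finite_vec_box)
qed

lemma tensor_translates_sum_to_one:
  fixes \<Phi> :: "real ^ 'n \<Rightarrow> 'k::{real_normed_field, banach}"
  assumes "tensor_mother_scaling_function \<Phi>"
    and A: "finite A" "{k. \<Phi> (x - vec_of_int k) \<noteq> 0} \<subseteq> A"
  shows "(\<Sum>k\<in>A. \<Phi> (x - vec_of_int k)) = 1"
proof -
  obtain \<phi> where \<phi>: "mother_scaling_function \<phi>" and \<Phi>: "\<Phi> = tensor_power \<phi>"
    using assms by (auto simp: tensor_mother_scaling_function_def)
  define S where "S i = {m::int. \<phi> (x $ i - of_int m) \<noteq> 0}" for i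
  have S: "finite (S i)" for i
    unfolding S_def by (rule finite_translate_support[OF \<phi>])
  have box: "{k. \<Phi> (x - vec_of_int k) \<noteq> 0} = {k. \<forall>i. k $ i \<in> S i}"
    by (auto simp: \<Phi> tensor_power_translate S_def)
  have "(\<Sum>k\<in>A. \<Phi> (x - vec_of_int k)) = (\<Sum>k\<in>{k. \<forall>i. k $ i \<in> S i}. \<Phi> (x - vec_of_int k))"
    using A unfolding box[symmetric] by (intro sum.mono_neutral_right) auto
  also have "\<dots> = (\<Prod>i\<in>UNIV. \<Sum>m\<in>S i. \<phi> (x $ i - of_int m))"
    unfolding \<Phi> tensor_power_translate using S by (rule sum_vec_box_prod)
  also have "\<dots> = 1"
  proof -
    have "(\<Sum>m\<in>S i. \<phi> (x $ i - of_int m)) = 1" for i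
      by (rule translates_sum_to_one[OF \<phi> S]) (auto simp: S_def)
    then show ?thesis
      by simp
  qed
  finally show ?thesis .
qed

lemma tensor_translates_abs_bounded:
  fixes \<Phi> :: "real ^ 'n \<Rightarrow> 'k::real_normed_field"
  assumes "tensor_mother_scaling_function \<Phi>"
  obtains C where "C > 0"
    "\<And>x A. finite A \<Longrightarrow> (\<Sum>k\<in>A. norm (\<Phi> (x - vec_of_int k))) \<le> C"
proof -
  obtain \<phi> where \<phi>: "mother_scaling_function \<phi>" and \<Phi>: "\<Phi> = tensor_power \<phi>"
    using assms by (auto simp: tensor_mother_scaling_function_def)
  obtain C where C: "C \<ge> 0" "\<And>x A. finite A \<Longrightarrow> (\<Sum>k\<in>A. norm (\<phi> (x - of_int k))) \<le> C"
    using translates_abs_bounded[OF \<phi>] by blast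
  have "(\<Sum>k\<in>A. norm (\<Phi> (x - vec_of_int k))) \<le> C ^ CARD('n) + 1"
    if "finite A" for x and A :: "(int ^ 'n) set"
  proof -
    define S where "S i = (\<lambda>k. k $ i) ` A" for i
    have S: "finite (S i)" for i
      unfolding S_def using that by simp
    have "(\<Sum>k\<in>A. norm (\<Phi> (x - vec_of_int k)))
        \<le> (\<Sum>k\<in>{k. \<forall>i. k $ i \<in> S i}. norm (\<Phi> (x - vec_of_int k)))"
      using finite_vec_box[OF S] by (intro sum_mono2) (auto simp: S_def)
    also have "\<dots> = (\<Prod>i\<in>UNIV. \<Sum>m\<in>S i. norm (\<phi> (x $ i - of_int m)))"
      unfolding \<Phi> tensor_power_translate prod_norm[symmetric] using S by (rule sum_vec_box_prod)
    also have "\<dots> \<le> (\<Prod>i\<in>(UNIV::'n set). C)"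
      using C(2)[OF S] by (intro prod_mono) (auto intro: sum_nonneg)
    finally show ?thesis
      by simp
  qed
  moreover have "C ^ CARD('n) + 1 > 0"
    using C(1) by (simp add: add_nonneg_pos)
  ultimately show thesis
    using that by blast
qed

section \<open>Functions vanishing at infinity\<close>

lemma c0_apply_sum: "c0_apply (sum g A) x = (\<Sum>k\<in>A. c0_apply (g k) x)"
  for g :: "'i \<Rightarrow> ('a::real_normed_vector, 'k::real_normed_field) c0"
  using blinfun.sum_right[of "c0_eval x" g A] by (simp add: c0_eval.rep_eq)

lemma c0_apply_diff: "c0_apply (f - g) x = c0_apply f x - c0_apply g x"
  for f :: "('a::real_normed_vector, 'k::real_normed_field) c0"
  using blinfun.diff_right[of "c0_eval x" f g] by (simp add: c0_eval.rep_eq)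

lemma norm_c0_le: "norm f \<le> b" if "\<And>x. norm (c0_apply f x) \<le> b"
  unfolding norm_c0_eq_SUP using that by (intro cSUP_least) auto

lemma c0_small_outside_ball:
  fixes f :: "('a::real_normed_vector, 'k::real_normed_vector) c0"
  assumes "e > 0"
  obtains B where "\<And>x. B \<le> norm x \<Longrightarrow> norm (c0_apply f x) < e"
proof -
  have "(c0_apply f \<longlongrightarrow> 0) at_infinity"
    unfolding c0_apply_def using bcontfun_of_c0[of f] by simp
  from tendstoD[OF this assms] show thesis
    using that by (auto simp: eventually_at_infinity)
qed

lemma c0_uniformly_continuous:
  fixes f :: "('a::euclidean_space, 'k::real_normed_vector) c0"
  assumes "e > 0"
  obtains d where "d > 0" "\<And>x y. dist x y < d \<Longrightarrow> norm (c0_apply f x - c0_apply f y) < e"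
proof -
  obtain B where B: "\<And>x. B \<le> norm x \<Longrightarrow> norm (c0_apply f x) < e / 2"
    using c0_small_outside_ball[of "e / 2" f] assms by auto
  have "continuous_on (cball 0 (B + 1)) (c0_apply f)"
    unfolding c0_apply_def by (auto intro!: continuous_intros)
  then have "uniformly_continuous_on (cball 0 (B + 1)) (c0_apply f)"
    by (rule compact_uniformly_continuous) simp
  then obtain d where d: "d > 0"
    "\<And>x y. norm x \<le> B + 1 \<Longrightarrow> norm y \<le> B + 1 \<Longrightarrow> dist y x < d
      \<Longrightarrow> dist (c0_apply f y) (c0_apply f x) < e"
    using assms unfolding uniformly_continuous_on_def by (auto simp: Ball_def)
  \<comment> \<open>Two points at distance below one lie both in the larger ball or both outside the smaller one.\<close>
  have "norm (c0_apply f x - c0_apply f y) < e" if xy: "dist x y < min d 1" for x y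
  proof (cases "norm x \<le> B + 1 \<and> norm y \<le> B + 1")
    case True
    then show ?thesis
      using d(2)[of y x] xy by (simp add: dist_norm)
  next
    case False
    have "\<bar>norm x - norm y\<bar> < 1"
      using norm_triangle_ineq3[of x y] xy by (simp add: dist_norm)
    then have "B \<le> norm x" "B \<le> norm y"
      using False by linarith+
    then have "norm (c0_apply f x) < e / 2" "norm (c0_apply f y) < e / 2"
      using B by auto
    then show ?thesis
      using norm_triangle_ineq4[of "c0_apply f x" "c0_apply f y"] by linarith
  qed
  then show thesis
    using that[of "min d 1"] d(1) by simp
qed

section \<open>The dual projections\<close>

lemma c0_dual_sum_scale:
  assumes "F \<in> c0_dual"
  shows "blinfun_apply F (\<Sum>k\<in>A. c0_scale (c k) (g k)) = (\<Sum>k\<in>A. c k * blinfun_apply F (g k))"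
  using assms by (simp add: c0_dual_def blinfun.sum_right)

text \<open>Multiplying each \<open>g k\<close> by the scalar that rotates \<open>F (g k)\<close> onto its norm turns the sum of norms into
  a single value of \<open>F\<close>, at a function whose supremum norm is at most \<open>C\<close>. This needs homogeneity of
  \<open>F\<close> over the scalar field, and is what makes the series of the dual projection converge.\<close>

lemma dual_abs_sum_le:
  fixes F :: "('a::real_normed_vector, 'k::real_normed_field) c0 \<Rightarrow>\<^sub>L 'k"
  assumes F: "F \<in> c0_dual"
    and C: "\<And>x. (\<Sum>k\<in>A. norm (c0_apply (g k) x)) \<le> C"
  shows "(\<Sum>k\<in>A. norm (blinfun_apply F (g k))) \<le> norm F * C"
proof -
  \<comment> \<open>Where \<open>F (g k)\<close> vanishes, division by zero makes the coefficient zero, as it should be.\<close>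
  define c where "c k = of_real (norm (blinfun_apply F (g k))) / blinfun_apply F (g k)" for k
  have c: "norm (c k) \<le> 1" "c k * blinfun_apply F (g k) = of_real (norm (blinfun_apply F (g k)))" for k
    by (auto simp: c_def norm_divide)
  have "norm (\<Sum>k\<in>A. c0_scale (c k) (g k)) \<le> C"
  proof (rule norm_c0_le)
    fix x
    have "norm (c0_apply (\<Sum>k\<in>A. c0_scale (c k) (g k)) x) \<le> (\<Sum>k\<in>A. norm (c0_apply (g k) x))"
      unfolding c0_apply_sum using c(1)
      by (intro sum_norm_le) (simp add: norm_mult mult_left_le_one_le)
    then show "norm (c0_apply (\<Sum>k\<in>A. c0_scale (c k) (g k)) x) \<le> C"
      using C[of x] by linarith
  qed
  moreover have "(\<Sum>k\<in>A. norm (blinfun_apply F (g k)))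
      = norm (blinfun_apply F (\<Sum>k\<in>A. c0_scale (c k) (g k)))"
    by (simp add: c0_dual_sum_scale[OF F] c(2) sum_nonneg flip: of_real_sum)
  ultimately show ?thesis
    using order_trans[OF norm_blinfun[of F "\<Sum>k\<in>A. c0_scale (c k) (g k)"]
        mult_left_mono[OF _ norm_ge_zero[of F]]] by simp
qed

lemma dual_projection_has_sum:
  fixes \<Phi> :: "real ^ 'n \<Rightarrow> 'k::{real_normed_field, banach}"
  assumes \<Phi>: "tensor_mother_scaling_function \<Phi>" and F: "F \<in> c0_dual"
  shows "((\<lambda>k. c0_apply f (vec_of_int k /\<^sub>R (2 powi j)) * blinfun_apply F (scaling_fun \<Phi> j k))
    has_sum blinfun_apply (dual_projection \<Phi> j F) f) UNIV"
proof -
  let ?T = "\<lambda>k. dual_scale (blinfun_apply F (scaling_fun \<Phi> j k)) (dual_scaling_functional j k)"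
  have apply_T: "blinfun_apply (?T k) h
      = c0_apply h (vec_of_int k /\<^sub>R (2 powi j)) * blinfun_apply F (scaling_fun \<Phi> j k)" for k h
    by (simp add: dual_scale_def dual_scaling_functional_def c0_eval.rep_eq)
  obtain C where C: "\<And>x A. finite A \<Longrightarrow> (\<Sum>k\<in>A. norm (\<Phi> (x - vec_of_int k))) \<le> C"
    using tensor_translates_abs_bounded[OF \<Phi>] by blast
  have "norm (?T k) \<le> norm (blinfun_apply F (scaling_fun \<Phi> j k))" for k
  proof (rule norm_blinfun_bound)
    show "norm (blinfun_apply (?T k) h) \<le> norm (blinfun_apply F (scaling_fun \<Phi> j k)) * norm h" for h
      unfolding apply_T norm_mult
      by (subst mult.commute) (intro mult_left_mono norm_c0_apply_le norm_ge_zero)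
  qed simp
  then have "(\<Sum>k\<in>A. norm (?T k)) \<le> (\<Sum>k\<in>A. norm (blinfun_apply F (scaling_fun \<Phi> j k)))" for A
    by (intro sum_mono)
  moreover have "(\<Sum>k\<in>A. norm (blinfun_apply F (scaling_fun \<Phi> j k))) \<le> norm F * C" if "finite A" for A
    by (rule dual_abs_sum_le[OF F]) (simp add: c0_apply_scaling_fun[OF \<Phi>] C[OF that])
  ultimately have "(\<Sum>k\<in>A. norm (?T k)) \<le> norm F * C" if "finite A" for A
    using that order_trans by blast
  then have "?T abs_summable_on UNIV"
    by (intro nonneg_bdd_above_summable_on bdd_aboveI2[where M = "norm F * C"]) auto
  then have "?T summable_on UNIV"
    by (rule abs_summable_summable)
  then have "(?T has_sum dual_projection \<Phi> j F) UNIV"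
    unfolding dual_projection_def by (rule has_sum_infsum)
  from has_sum_bounded_linear[OF blinfun.bounded_linear_left[of f] this] show ?thesis
    by (simp add: apply_T)
qed

lemma dual_projection_in_c0_dual:
  fixes \<Phi> :: "real ^ 'n \<Rightarrow> 'k::{real_normed_field, banach}"
  assumes \<Phi>: "tensor_mother_scaling_function \<Phi>" and F: "F \<in> c0_dual"
  shows "dual_projection \<Phi> j F \<in> c0_dual"
  unfolding c0_dual_def
proof (intro CollectI allI)
  fix c f
  have "((\<lambda>k. c * (c0_apply f (vec_of_int k /\<^sub>R (2 powi j)) * blinfun_apply F (scaling_fun \<Phi> j k)))
      has_sum blinfun_apply (dual_projection \<Phi> j F) (c0_scale c f)) UNIV"
    using dual_projection_has_sum[OF \<Phi> F, of "c0_scale c f" j] by (simp add: mult.assoc)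
  from has_sum_unique[OF this has_sum_cmult_right[OF dual_projection_has_sum[OF \<Phi> F]]]
  show "blinfun_apply (dual_projection \<Phi> j F) (c0_scale c f)
      = c * blinfun_apply (dual_projection \<Phi> j F) f" .
qed

lemma finite_vec_of_int_ball: "finite {k :: int ^ 'n. norm (vec_of_int k) \<le> B}"
proof (rule finite_subset)
  show "{k :: int ^ 'n. norm (vec_of_int k) \<le> B} \<subseteq> {k. \<forall>i. k $ i \<in> {m. \<bar>1 * of_int m + 0\<bar> \<le> B}}"
  proof clarsimp
    fix k :: "int ^ 'n" and i
    assume "norm (vec_of_int k) \<le> B"
    then show "\<bar>of_int (k $ i)\<bar> \<le> B"
      using component_le_norm_cart[of "vec_of_int k" i] by (simp add: vec_of_int_def)
  qed
  show "finite {k :: int ^ 'n. \<forall>i. k $ i \<in> {m. \<bar>1 * of_int m + 0\<bar> \<le> B}}"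
    by (intro finite_vec_box finite_int_affine_abs_le) simp
qed

text \<open>The sum is over finite sets \<open>A\<close> of grid indices containing all points at which \<open>f\<close> is not small,
  rather than over the whole grid. Completing \<open>A\<close> to a set \<open>E\<close> that also contains every translate
  active at \<open>x\<close>, the error is the full interpolation error over \<open>E\<close> minus the contribution of
  \<open>E - A\<close>. The first is small by uniform continuity and the partition of unity, the second because
  \<open>f\<close> is small at the added grid points; both use the uniform bound \<open>C\<close> on the absolute sum.\<close>

lemma interpolation_converges:
  fixes \<Phi> :: "real ^ 'n \<Rightarrow> 'k::{real_normed_field, banach}"
  assumes \<Phi>: "tensor_mother_scaling_function \<Phi>" and e: "e > 0"
  shows "\<forall>\<^sub>F j in at_top. \<forall>\<^sub>F A in finite_subsets_at_top UNIV.
    norm ((\<Sum>k\<in>A. c0_scale (c0_apply f (vec_of_int k /\<^sub>R (2 powi j))) (scaling_fun \<Phi> j k)) - f) \<le> e"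
proof -
  obtain R where R: "R > 0" "\<And>y. \<Phi> y \<noteq> 0 \<Longrightarrow> norm y \<le> R"
    using tensor_support[OF \<Phi>] by blast
  obtain C where C: "C > 0" "\<And>x A. finite A \<Longrightarrow> (\<Sum>k\<in>A. norm (\<Phi> (x - vec_of_int k))) \<le> C"
    using tensor_translates_abs_bounded[OF \<Phi>] by blast
  define \<epsilon> where "\<epsilon> = e / (2 * C)"
  have \<epsilon>: "\<epsilon> > 0" "\<epsilon> * C + \<epsilon> * C = e"
    using e C(1) by (auto simp: \<epsilon>_def field_simps)
  obtain d where d: "d > 0" "\<And>x y. dist x y < d \<Longrightarrow> norm (c0_apply f x - c0_apply f y) < \<epsilon>"
    using c0_uniformly_continuous[OF \<epsilon>(1), of f] by blast
  obtain B where B: "\<And>x. B \<le> norm x \<Longrightarrow> norm (c0_apply f x) < \<epsilon>"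
    using c0_small_outside_ball[OF \<epsilon>(1), of f] by blast
  obtain N :: nat where N: "R / d < 2 ^ N"
    using real_arch_pow[of 2 "R / d"] by auto
  have fine: "\<forall>\<^sub>F A in finite_subsets_at_top UNIV.
    norm ((\<Sum>k\<in>A. c0_scale (c0_apply f (vec_of_int k /\<^sub>R (2 powi j))) (scaling_fun \<Phi> j k)) - f) \<le> e"
    if j: "j \<ge> int N" for j
  proof -
    define s :: real where "s = 2 powi j"
    define p where "p k = vec_of_int k /\<^sub>R s" for k :: "int ^ 'n"
    have "2 powi (int N) \<le> s"
      unfolding s_def using j by (intro power_int_increasing) auto
    then have "R / d < s"
      using N by simp
    then have s: "s > 0" "R < d * s"
      using R(1) d(1) by (auto simp: s_def field_simps)
    define A0 where "A0 = {k. norm (vec_of_int k :: real ^ 'n) \<le> B * s}"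
    have tail: "norm (c0_apply f (p k)) \<le> \<epsilon>" if "k \<notin> A0" for k
    proof -
      have "B * s \<le> norm (vec_of_int k :: real ^ 'n)"
        using that by (simp add: A0_def)
      then have "B \<le> norm (p k)"
        using s(1) by (simp add: p_def field_simps)
      then show ?thesis
        using B less_imp_le by blast
    qed
    have near: "norm ((c0_apply f (p k) - c0_apply f x) * \<Phi> (s *\<^sub>R x - vec_of_int k))
        \<le> \<epsilon> * norm (\<Phi> (s *\<^sub>R x - vec_of_int k))" for k x
    proof (cases "\<Phi> (s *\<^sub>R x - vec_of_int k) = 0")
      case False
      have "s *\<^sub>R x - vec_of_int k = s *\<^sub>R (x - p k)"
        using s(1) by (simp add: p_def scaleR_diff_right)
      then have "s * norm (x - p k) \<le> R"
        using R(2)[OF False] s(1) by simp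
      then have "s * norm (x - p k) < s * d"
        using s(2) by (simp add: mult.commute)
      then have "dist (p k) x < d"
        using s(1) by (simp add: dist_norm norm_minus_commute)
      then show ?thesis
        unfolding norm_mult by (intro mult_right_mono) (auto intro: less_imp_le d(2))
    qed simp
    have "norm ((\<Sum>k\<in>A. c0_scale (c0_apply f (p k)) (scaling_fun \<Phi> j k)) - f) \<le> e"
      if A: "finite A" "A0 \<subseteq> A" for A
    proof (rule norm_c0_le)
      fix x
      define w where "w k = \<Phi> (s *\<^sub>R x - vec_of_int k)" for k
      define E where "E = A \<union> {k. w k \<noteq> 0}"
      have E: "finite E" "A \<subseteq> E" "{k. w k \<noteq> 0} \<subseteq> E"
        using A(1) tensor_translates_finite[OF \<Phi>] by (auto simp: E_def w_def)
      have one: "(\<Sum>k\<in>E. w k) = 1"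
        using tensor_translates_sum_to_one[OF \<Phi> E(1)] E(3) unfolding w_def by blast
      have bound: "(\<Sum>k\<in>D. \<epsilon> * norm (w k)) \<le> \<epsilon> * C" if "finite D" for D
        using C(2)[OF that] \<epsilon>(1) by (simp add: w_def mult_left_mono flip: sum_distrib_left)
      have "(\<Sum>k\<in>E. (c0_apply f (p k) - c0_apply f x) * w k)
          = (\<Sum>k\<in>E. c0_apply f (p k) * w k) - c0_apply f x"
        by (simp add: left_diff_distrib sum_subtractf one flip: sum_distrib_left)
      moreover have "(\<Sum>k\<in>E. c0_apply f (p k) * w k)
          = (\<Sum>k\<in>E - A. c0_apply f (p k) * w k) + (\<Sum>k\<in>A. c0_apply f (p k) * w k)"
        by (rule sum.subset_diff[OF E(2,1)])
      ultimately have "c0_apply ((\<Sum>k\<in>A. c0_scale (c0_apply f (p k)) (scaling_fun \<Phi> j k)) - f) x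
          = (\<Sum>k\<in>E. (c0_apply f (p k) - c0_apply f x) * w k) - (\<Sum>k\<in>E - A. c0_apply f (p k) * w k)"
        by (simp add: c0_apply_diff c0_apply_sum c0_apply_scaling_fun[OF \<Phi>] w_def s_def)
      also have "norm \<dots> \<le> norm (\<Sum>k\<in>E. (c0_apply f (p k) - c0_apply f x) * w k)
          + norm (\<Sum>k\<in>E - A. c0_apply f (p k) * w k)"
        by (rule norm_triangle_ineq4)
      also have "norm (\<Sum>k\<in>E. (c0_apply f (p k) - c0_apply f x) * w k) \<le> (\<Sum>k\<in>E. \<epsilon> * norm (w k))"
        unfolding w_def by (intro sum_norm_le near)
      also have "\<dots> \<le> \<epsilon> * C"
        by (rule bound[OF E(1)])
      also have "norm (\<Sum>k\<in>E - A. c0_apply f (p k) * w k) \<le> (\<Sum>k\<in>E - A. \<epsilon> * norm (w k))"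
        using A(2) tail by (intro sum_norm_le) (auto simp: norm_mult intro!: mult_right_mono)
      also have "\<dots> \<le> \<epsilon> * C"
        using E(1) by (intro bound) simp
      finally show "norm (c0_apply ((\<Sum>k\<in>A. c0_scale (c0_apply f (p k)) (scaling_fun \<Phi> j k)) - f) x) \<le> e"
        using \<epsilon>(2) by simp
    qed
    moreover have "finite A0"
      unfolding A0_def by (rule finite_vec_of_int_ball)
    ultimately show ?thesis
      unfolding eventually_finite_subsets_at_top p_def s_def by blast
  qed
  then show ?thesis
    unfolding eventually_at_top_linorder by blast
qed

text \<open>For fixed \<open>j\<close>, the partial sums of the dual series at \<open>f\<close> are the values of \<open>F\<close> at the finite
  interpolation sums, so the uniform estimate above passes to the limit over finite index sets.\<close>

lemma dual_projection_tendsto: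
  fixes \<Phi> :: "real ^ 'n \<Rightarrow> 'k::{real_normed_field, banach}"
  assumes \<Phi>: "tensor_mother_scaling_function \<Phi>" and F: "F \<in> c0_dual"
  shows "((\<lambda>j. blinfun_apply (dual_projection \<Phi> j F) f) \<longlongrightarrow> blinfun_apply F f) at_top"
proof (rule tendstoI)
  fix e :: real
  assume "e > 0"
  define d where "d = e / (norm F + 1)"
  have "norm F + 1 > 0"
    by (simp add: add_nonneg_pos)
  then have d: "d > 0" "norm F * d < e"
    using \<open>e > 0\<close> by (simp_all add: d_def divide_less_eq algebra_simps)
  show "\<forall>\<^sub>F j in at_top. dist (blinfun_apply (dual_projection \<Phi> j F) f) (blinfun_apply F f) < e"
    using interpolation_converges[OF \<Phi> d(1), of f]
  proof eventually_elim
    case (elim j)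
    let ?g = "\<lambda>A. \<Sum>k\<in>A. c0_scale (c0_apply f (vec_of_int k /\<^sub>R (2 powi j))) (scaling_fun \<Phi> j k)"
    have "((\<lambda>A. blinfun_apply F (?g A)) \<longlongrightarrow> blinfun_apply (dual_projection \<Phi> j F) f)
        (finite_subsets_at_top UNIV)"
      using dual_projection_has_sum[OF \<Phi> F, of f j] by (simp add: has_sum_def c0_dual_sum_scale[OF F])
    then have lim: "((\<lambda>A. blinfun_apply F (?g A - f))
        \<longlongrightarrow> blinfun_apply (dual_projection \<Phi> j F) f - blinfun_apply F f) (finite_subsets_at_top UNIV)"
      unfolding blinfun.diff_right by (intro tendsto_diff tendsto_const)
    have "\<forall>\<^sub>F A in finite_subsets_at_top UNIV. norm (blinfun_apply F (?g A - f)) \<le> norm F * d"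
      using elim
    proof eventually_elim
      case (elim A)
      then show ?case
        using norm_blinfun[of F "?g A - f"] by (meson mult_left_mono norm_ge_zero order_trans)
    qed
    from Lim_norm_ubound[OF _ lim this]
    have "norm (blinfun_apply (dual_projection \<Phi> j F) f - blinfun_apply F f) \<le> norm F * d"
      by simp
    then show ?case
      using d(2) by (simp add: dist_norm)
  qed
qed

text \<open>The strong operator topology is pulled back from the product topology on functions, where
  limits are componentwise.\<close>

lemma limitin_strong_operator_topology:
  fixes G :: "'i \<Rightarrow> 'a::real_normed_vector \<Rightarrow>\<^sub>L 'b::real_normed_vector"
  assumes "\<And>x. ((\<lambda>i. blinfun_apply (G i) x) \<longlongrightarrow> blinfun_apply L x) net"
  shows "limitin strong_operator_topology G L net"
proof -
  have "limitin (product_topology (\<lambda>_. euclidean) UNIV) (\<lambda>i. blinfun_apply (G i)) (blinfun_apply L) net"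
    using assms by (simp add: limitin_componentwise)
  then have lim: "limitin euclidean (\<lambda>i. blinfun_apply (G i)) (blinfun_apply L) net"
    by (simp add: euclidean_product_topology)
  show ?thesis
    unfolding limitin_def
  proof (intro conjI allI impI)
    fix U
    assume "openin strong_operator_topology U \<and> L \<in> U"
    then obtain V where V: "open V" "U = blinfun_apply -` V" "blinfun_apply L \<in> V"
      by (auto simp: strong_operator_topology_def openin_pullback_topology)
    then show "\<forall>\<^sub>F i in net. G i \<in> U"
      using lim by (auto simp: limitin_def)
  qed (simp add: strong_operator_topology_topspace)
qed

lemma dual_projection_weak_star_limit:
  fixes \<Phi> :: "real ^ 'n \<Rightarrow> 'k::{real_normed_field, banach}"
  assumes \<Phi>: "tensor_mother_scaling_function \<Phi>" and F: "F \<in> c0_dual"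
  shows "limitin weak_star_topology (\<lambda>j. dual_projection \<Phi> j F) F at_top"
  unfolding weak_star_topology_def limitin_subtopology
  using F dual_projection_in_c0_dual[OF assms]
  by (auto intro!: limitin_strong_operator_topology dual_projection_tendsto[OF assms])

theorem theorem8p15:
  shows "(\<forall>(\<Phi> :: real ^ 'n \<Rightarrow> real) F.
            tensor_mother_scaling_function \<Phi> \<longrightarrow> F \<in> c0_dual \<longrightarrow>
            limitin weak_star_topology (\<lambda>j::int. dual_projection \<Phi> j F) F at_top)
       \<and> (\<forall>(\<Phi> :: real ^ 'n \<Rightarrow> complex) F.
            tensor_mother_scaling_function \<Phi> \<longrightarrow> F \<in> c0_dual \<longrightarrow>
            limitin weak_star_topology (\<lambda>j::int. dual_projection \<Phi> j F) F at_top)"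
  by (intro conjI allI impI dual_projection_weak_star_limit)

end
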